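(* Let $0<\rho\le1$, $L_0>0$, $L_1\ge0$, and let $f:\mathbb{R}^d\to\mathbb{R}\cup\{\infty\}$ be $(\rho,L_0,L_1)$-smooth and convex, attaining its minimum at $x_*\in\mathbb{R}^d$. Let $x_0\in\mathcal{X}$, $R:=\|x_0-x_*\|$, $\ell(s)=L_0+L_1s^\rho$, and let $\{x_k\}_{k\ge0}$ be generated by $$x_{k+1}=x_k-\gamma_k\nabla f(x_k),\qquad \gamma_k=\int_0^1\frac{dv}{\ell(\|\nabla f(x_k)\|+\|\nabla f(x_k)\|v)}.$$ Then for every $\varepsilon>0$, with $$T:=\left\lceil\max\left\{\frac{2L_0R^2}{\varepsilon},\frac{16L_1^{2/(2-\rho)}R^2}{\varepsilon^{2(1-\rho)/(2-\rho)}}\right\}\right\rceil$$ one has $f(x_T)-f(x_* )\le\varepsilon$.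
   Context: Norms are Euclidean for vectors and spectral for matrices. For $f:\mathbb{R}^d\to\mathbb{R}\cup\{\infty\}$ put $\mathcal{X}=\{x\in\mathbb{R}^d: f(x)<\infty\}$, assumed to be open and convex. $f$ is $(\rho,L_0,L_1)$-smooth if $f$ is twice differentiable on $\mathcal{X}$, continuous on the closure of $\mathcal{X}$ (as a map into $\mathbb{R}\cup\{\infty\}$), and $\|\nabla^2f(x)\|\le L_0+L_1\|\nabla f(x)\|^\rho$ for all $x\in\mathcal{X}$. (The iteration is well defined: the iterates stay in $\mathcal{X}$.) *)

theory Defs
  imports "HOL-Analysis.Analysis"
begin

definition eff_domain :: "('a \<Rightarrow> ereal) \<Rightarrow> 'a set"
  where "eff_domain f = {x. f x < \<infinity>}"

text \<open>
  The gradient and the Hessian of an extended-valued function are those of its real part.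
  On an open effective domain the two functions agree near every point; outside that
  domain the values are irrelevant.
\<close>

definition grad :: "(real ^ 'n \<Rightarrow> ereal) \<Rightarrow> real ^ 'n \<Rightarrow> real ^ 'n"
  where "grad f x = (THE D. GDERIV (\<lambda>y. real_of_ereal (f y)) x :> D)"

definition hessian :: "(real ^ 'n \<Rightarrow> ereal) \<Rightarrow> real ^ 'n \<Rightarrow> real ^ 'n ^ 'n"
  where "hessian f x = jacobian (grad f) (at x)"

definition twice_differentiable_on :: "(real ^ 'n \<Rightarrow> ereal) \<Rightarrow> (real ^ 'n) set \<Rightarrow> bool"
  where "twice_differentiable_on f S \<longleftrightarrow>
    (\<forall>x\<in>S. (\<lambda>y. real_of_ereal (f y)) differentiable (at x) \<and> grad f differentiable (at x))"

text \<open>The norm on \<^typ>\<open>real ^ 'n ^ 'n\<close> provided by the library is the Frobenius norm.\<close>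

definition spectral_norm :: "real ^ 'n ^ 'm \<Rightarrow> real"
  where "spectral_norm A = onorm ((*v) A)"

definition ell :: "real \<Rightarrow> real \<Rightarrow> real \<Rightarrow> real \<Rightarrow> real"
  where "ell \<rho> L0 L1 s = L0 + L1 * s powr \<rho>"

text \<open>
  The condition \<^prop>\<open>\<forall>x. f x \<noteq> - \<infinity>\<close> restricts the values of \<open>f\<close> to the reals and
  \<^term>\<open>\<infinity> :: ereal\<close>; continuity on the closure is with respect to the topology of
  \<^typ>\<open>ereal\<close>, so \<open>f\<close> tends to \<^term>\<open>\<infinity> :: ereal\<close> at the boundary points of the domain.
\<close>

definition gen_smooth :: "real \<Rightarrow> real \<Rightarrow> real \<Rightarrow> (real ^ 'n \<Rightarrow> ereal) \<Rightarrow> bool"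
  where "gen_smooth \<rho> L0 L1 f \<longleftrightarrow>
    (\<forall>x. f x \<noteq> - \<infinity>) \<and>
    open (eff_domain f) \<and> convex (eff_domain f) \<and>
    twice_differentiable_on f (eff_domain f) \<and>
    continuous_on (closure (eff_domain f)) f \<and>
    (\<forall>x\<in>eff_domain f. spectral_norm (hessian f x) \<le> ell \<rho> L0 L1 (norm (grad f x)))"

definition ext_convex :: "('a::real_vector \<Rightarrow> ereal) \<Rightarrow> bool"
  where "ext_convex f \<longleftrightarrow>
    (\<forall>x y t. 0 < t \<and> t < 1 \<longrightarrow>
      f ((1 - t) *\<^sub>R x + t *\<^sub>R y) \<le> ereal (1 - t) * f x + ereal t * f y)"

definition step_size :: "real \<Rightarrow> real \<Rightarrow> real \<Rightarrow> (real ^ 'n \<Rightarrow> ereal) \<Rightarrow> real ^ 'n \<Rightarrow> real"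
  where "step_size \<rho> L0 L1 f x =
    integral {0..1} (\<lambda>v. 1 / ell \<rho> L0 L1 (norm (grad f x) + norm (grad f x) * v))"

end

theory Submission imports Defs begin

text \<open>
  Write \<open>lam\<close> for the bound on the Hessian as a function of the gradient norm,
  \<open>M\<^sub>k\<close> for the norm of the gradient at the iterate \<open>x\<^sub>k\<close>, \<open>\<Delta>\<^sub>k\<close> for the gap
  \<open>f x\<^sub>k - f x\<^sub>*\<close> and \<open>\<gamma>\<^sub>k\<close> for the step size.

  The standard analysis of gradient descent on a convex function with Lipschitz gradient
  shows that the squared distance to the minimizer drops by \<open>2 \<gamma>\<^sub>k \<Delta>\<^sub>k\<close> in each step.
  Here the gradient is only locally Lipschitz, but its growth can be controlled: along a
  ray of unit speed the change of the gradient is dominated by the solution of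
  \<open>p' = lam p\<close> starting at the initial gradient norm (\<open>growth_comparison\<close>,
  \<open>grad_change_time\<close>).  The same control keeps such a ray inside the domain
  (\<open>ray_in_dom\<close>) and gives a quadratic upper bound on short pieces of it (\<open>descent\<close>).
  This is used in three ways.

  The step length \<open>\<gamma>\<^sub>k M\<^sub>k\<close> is the time at which \<open>p\<close> has doubled from \<open>M\<^sub>k\<close> to
  \<open>2 M\<^sub>k\<close>.  So the gradient changes by at most \<open>M\<^sub>k\<close> during the step and does not turn
  against the old one, whence \<open>f\<close> does not increase (\<open>step_decreases\<close>).

  Walking from the minimizer in the direction of the gradient at \<open>x\<^sub>k\<close> gives a
  cocoercivity inequality with the term \<open>M\<^sub>k\<^sup>2 / (2 lam M\<^sub>k)\<close>.  It absorbs the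
  quadratic error term of the recursion because \<open>\<gamma>\<^sub>k \<le> 1 / lam M\<^sub>k\<close>
  (\<open>distance_recursion\<close>).

  Walking from \<open>x\<^sub>k\<close> against its gradient gives \<open>M\<^sub>k\<^sup>2 / (2 lam (2 M\<^sub>k)) \<le> \<Delta>\<^sub>k\<close>
  (\<open>gap_ge_grad\<close>).  A large gradient, which makes the step short, therefore forces a
  large gap.  For \<open>lam s = L0 + L1 s powr \<rho>\<close> and \<open>\<Delta>\<^sub>k > \<epsilon>\<close> this bounds the progress
  \<open>2 \<gamma>\<^sub>k \<Delta>\<^sub>k\<close> from below by \<open>R\<^sup>2 / T\<close> (\<open>gap_over_rate\<close>), where the two terms of the
  maximum defining \<open>T\<close> correspond to the dominating summand of \<open>lam\<close>.  If the gap
  exceeded \<open>\<epsilon>\<close> at \<open>x\<^sub>T\<close>, it would do so at all of the \<open>T + 1\<close> points up to \<open>x\<^sub>T\<close>, and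
  the total progress would exceed \<open>R\<^sup>2\<close> (\<open>last_iterate_gap\<close>).
\<close>

section \<open>Comparison with the scalar growth equation\<close>

locale growth_rate =
  fixes lam :: "real \<Rightarrow> real"
  assumes lam_cont: "continuous_on {0..} lam"
    and lam_pos: "\<And>s. 0 \<le> s \<Longrightarrow> 0 < lam s"
    and lam_mono: "\<And>s t. 0 \<le> s \<Longrightarrow> s \<le> t \<Longrightarrow> lam s \<le> lam t"
begin

text \<open>
  The solution of \<open>p' = lam p\<close> with \<open>p 0 = a\<close> reaches the value \<open>a + b\<close> at time
  \<open>growth_time a b\<close>.  Working with this inverse function instead of \<open>p\<close> makes
  it unnecessary to solve the differential equation.
\<close>

definition growth_time :: "real \<Rightarrow> real \<Rightarrow> real"
  where "growth_time a b = integral {0..b} (\<lambda>v. 1 / lam (a + v))"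

lemma rate_continuous:
  assumes "0 \<le> a"
  shows "continuous_on {0..b} (\<lambda>v. 1 / lam (a + v))"
proof -
  have "continuous_on {0..b} (\<lambda>v. lam (a + v))"
    using assms by (intro continuous_on_compose2[OF lam_cont] continuous_intros) auto
  moreover have "lam (a + v) \<noteq> 0" if "v \<in> {0..b}" for v
    using lam_pos[of "a + v"] assms that by auto
  ultimately show ?thesis
    by (intro continuous_intros) auto
qed

lemma growth_time_deriv_within:
  assumes "0 \<le> a" "t \<in> {0..b}"
  shows "(growth_time a has_real_derivative 1 / lam (a + t)) (at t within {0..b})"
  unfolding growth_time_def
  using integral_has_real_derivative[OF rate_continuous[OF assms(1)] assms(2)] .

lemma growth_time_deriv:
  assumes "0 \<le> a" "0 < t"
  shows "(growth_time a has_real_derivative 1 / lam (a + t)) (at t)"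
proof -
  have "(growth_time a has_real_derivative 1 / lam (a + t)) (at t within {0..t + 1})"
    by (rule growth_time_deriv_within) (use assms in auto)
  moreover have "at t within {0..t + 1} = at t"
    by (rule at_within_interior) (use assms in auto)
  ultimately show ?thesis by simp
qed

lemma growth_time_continuous:
  assumes "0 \<le> a"
  shows "continuous_on {0..} (growth_time a)"
proof -
  have "continuous (at t within {0..}) (growth_time a)" if "0 \<le> t" for t
  proof -
    have "continuous (at t within {0..t + 1}) (growth_time a)"
      by (rule DERIV_continuous[OF growth_time_deriv_within]) (use assms that in auto)
    moreover have "at t within {0..t + 1} = at t within {0..}"
      by (rule at_within_nhd[of _ "{t - 1<..<t + 1}"]) auto
    ultimately show ?thesis by simp
  qed
  then show ?thesis
    by (auto simp: continuous_on_eq_continuous_within)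
qed

lemma growth_time_0 [simp]: "growth_time a 0 = 0"
  by (simp add: growth_time_def)

lemma growth_time_strict_mono:
  assumes "0 \<le> a" "0 \<le> b" "b < c"
  shows "growth_time a b < growth_time a c"
proof (rule DERIV_pos_imp_increasing_open[where f = "growth_time a"])
  fix t assume "b < t" "t < c"
  then show "\<exists>y. (growth_time a has_real_derivative y) (at t) \<and> 0 < y"
    using growth_time_deriv[of a t] lam_pos[of "a + t"] assms
    by (intro exI[of _ "1 / lam (a + t)"]) auto
next
  show "continuous_on {b..c} (growth_time a)"
    by (rule continuous_on_subset[OF growth_time_continuous]) (use assms in auto)
qed fact

lemma growth_time_le_iff:
  assumes "0 \<le> a" "0 \<le> b" "0 \<le> c"
  shows "growth_time a b \<le> growth_time a c \<longleftrightarrow> b \<le> c"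
  using growth_time_strict_mono[of a b c] growth_time_strict_mono[of a c b] assms
  by (metis linorder_not_less order_less_imp_le linorder_cases order_refl)

lemma growth_time_lower:
  assumes "0 \<le> a" "0 \<le> b" "b \<le> M"
  shows "b / lam (a + M) \<le> growth_time a b"
proof -
  have "integral {0..b} (\<lambda>v. 1 / lam (a + M)) \<le> integral {0..b} (\<lambda>v. 1 / lam (a + v))"
    using assms lam_pos lam_mono
    by (intro integral_le integrable_continuous_real rate_continuous continuous_intros)
       (auto intro!: divide_left_mono mult_pos_pos)
  then show ?thesis using assms by (simp add: growth_time_def)
qed

lemma growth_time_upper:
  assumes "0 \<le> a" "0 \<le> b"
  shows "growth_time a b \<le> b / lam a"
proof -
  have "integral {0..b} (\<lambda>v. 1 / lam (a + v)) \<le> integral {0..b} (\<lambda>v. 1 / lam a)"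
    using assms lam_pos lam_mono
    by (intro integral_le integrable_continuous_real rate_continuous continuous_intros)
       (auto intro!: divide_left_mono mult_pos_pos)
  then show ?thesis using assms by (simp add: growth_time_def)
qed

text \<open>
  The integral on the right is the step size at a point with gradient norm \<open>M\<close>, so the
  distance covered by the step is the doubling time of the growth equation.
\<close>

lemma growth_time_rescale:
  assumes "0 \<le> M"
  shows "growth_time M M = M * integral {0..1} (\<lambda>v. 1 / lam (M + M * v))"
proof -
  have img: "(\<lambda>v. M * v) ` {0..1} \<subseteq> {0..M}"
    using assms using assms by (auto intro: mult_left_le)
  have "((\<lambda>v. M * (1 / lam (M + M * v))) has_integral
      growth_time M (M * 1) - growth_time M (M * 0)) {0..1}"
  proof (rule fundamental_theorem_of_calculus)
    fix v :: real assume v: "v \<in> {0..1}"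
    have "(growth_time M has_real_derivative 1 / lam (M + M * v))
        (at (M * v) within (\<lambda>v. M * v) ` {0..1})"
      by (rule DERIV_subset[OF growth_time_deriv_within img]) (use v img assms in blast)+
    moreover have "((\<lambda>v. M * v) has_real_derivative M) (at v within {0..1})"
      by (auto intro!: derivative_eq_intros)
    ultimately have "(growth_time M \<circ> (\<lambda>v. M * v) has_real_derivative
        1 / lam (M + M * v) * M) (at v within {0..1})"
      by (rule DERIV_image_chain)
    then show "((\<lambda>v. growth_time M (M * v)) has_vector_derivative M * (1 / lam (M + M * v)))
        (at v within {0..1})"
      by (simp add: has_real_derivative_iff_has_vector_derivative o_def mult.commute)
  qed simp
  then have "integral {0..1} (\<lambda>v. M * (1 / lam (M + M * v))) = growth_time M M"
    by (simp add: integral_unique)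
  then show ?thesis by (simp only: integral_mult_right)
qed

text \<open>
  A comparison principle: if a curve starting at the origin has speed at most
  \<open>lam (a + norm h)\<close>, then \<open>growth_time a (norm h)\<close> grows with speed at most 1.  The
  norm is not differentiable at the origin, so it is replaced by
  \<open>sqrt (norm h ^ 2 + \<delta> ^ 2)\<close>, whose derivative is at most \<open>norm h'\<close>, and \<open>\<delta>\<close> tends to 0.
\<close>

lemma growth_comparison:
  fixes h :: "real \<Rightarrow> 'b::real_inner"
  assumes a: "0 \<le> a" and s: "0 \<le> s" and h0: "h 0 = 0"
    and deriv: "\<And>t. 0 \<le> t \<Longrightarrow> t \<le> s \<Longrightarrow>
      \<exists>h'. (h has_vector_derivative h') (at t) \<and> norm h' \<le> lam (a + norm (h t))"
  shows "growth_time a (norm (h s)) \<le> s"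
proof -
  define N where "N \<delta> t = sqrt (h t \<bullet> h t + \<delta>\<^sup>2)" for \<delta> t :: real
  have bound: "growth_time a (N \<delta> s) \<le> growth_time a \<delta> + s" if \<delta>: "0 < \<delta>" for \<delta>
  proof -
    have "growth_time a (N \<delta> s) - s \<le> growth_time a (N \<delta> 0) - 0"
    proof (rule DERIV_nonpos_imp_nonincreasing[OF s])
      fix t assume t: "0 \<le> t" "t \<le> s"
      obtain h' where h': "(h has_vector_derivative h') (at t)" "norm h' \<le> lam (a + norm (h t))"
        using deriv[OF t] by blast
      have pos: "0 < h t \<bullet> h t + \<delta>\<^sup>2"
        using \<delta> by (simp add: add_nonneg_pos)
      then have Npos: "0 < N \<delta> t" by (simp add: N_def)
      have hN: "norm (h t) \<le> N \<delta> t"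
        unfolding N_def norm_eq_sqrt_inner by simp
      have "((\<lambda>t. h t \<bullet> h t) has_real_derivative 2 * (h t \<bullet> h')) (at t)"
        using bounded_bilinear.has_vector_derivative[OF bounded_bilinear_inner h'(1) h'(1)]
        by (simp add: has_real_derivative_iff_has_vector_derivative inner_commute)
      then have dN: "(N \<delta> has_real_derivative (h t \<bullet> h') / N \<delta> t) (at t)"
        unfolding N_def using pos by (auto intro!: derivative_eq_intros simp: field_simps)
      have dG: "((\<lambda>t. growth_time a (N \<delta> t) - t) has_real_derivative
          1 / lam (a + N \<delta> t) * ((h t \<bullet> h') / N \<delta> t) - 1) (at t)"
        by (intro DERIV_diff DERIV_chain2[OF growth_time_deriv dN] DERIV_ident a Npos)
      have "h t \<bullet> h' \<le> norm (h t) * norm h'" by (rule norm_cauchy_schwarz)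
      also have "\<dots> \<le> N \<delta> t * lam (a + N \<delta> t)"
        using hN h'(2) lam_mono[of "a + norm (h t)" "a + N \<delta> t"] a Npos by (intro mult_mono) auto
      finally have "1 / lam (a + N \<delta> t) * ((h t \<bullet> h') / N \<delta> t) - 1 \<le> 0"
        using Npos lam_pos[of "a + N \<delta> t"] a by (simp add: field_simps)
      with dG show "\<exists>y. ((\<lambda>t. growth_time a (N \<delta> t) - t) has_real_derivative y) (at t) \<and> y \<le> 0"
        by blast
    qed
    then show ?thesis using \<delta> by (simp add: N_def h0)
  qed
  have "((\<lambda>\<delta>. growth_time a \<delta>) \<longlongrightarrow> growth_time a 0) (at 0 within {0..})"
    using growth_time_continuous[OF a] unfolding continuous_on_def by blast
  then have lim0: "((\<lambda>\<delta>. growth_time a \<delta> + s) \<longlongrightarrow> 0 + s) (at_right 0)"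
    by (intro tendsto_add tendsto_const)
       (auto intro: tendsto_within_subset simp: growth_time_def)
  show ?thesis
  proof (rule tendsto_lowerbound[OF lim0[simplified]])
    have "growth_time a (norm (h s)) \<le> growth_time a \<delta> + s" if "0 < \<delta>" for \<delta>
    proof -
      have "norm (h s) \<le> N \<delta> s" unfolding N_def norm_eq_sqrt_inner by simp
      then have "growth_time a (norm (h s)) \<le> growth_time a (N \<delta> s)"
        using a by (subst growth_time_le_iff) (auto intro: order_trans[OF norm_ge_zero])
      then show ?thesis using bound[OF that] by simp
    qed
    then show "\<forall>\<^sub>F \<delta> in at_right 0. growth_time a (norm (h s)) \<le> growth_time a \<delta> + s"
      by (auto simp: eventually_at_filter)
  qed simp
qed

end


section \<open>Gradients along rays\<close>

lemma GDERIV_grad: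
  assumes "(\<lambda>y. real_of_ereal (f y)) differentiable (at x)"
  shows "GDERIV (\<lambda>y. real_of_ereal (f y)) x :> grad f x"
proof -
  let ?F = "\<lambda>y. real_of_ereal (f y)"
  obtain F' where F': "(?F has_derivative F') (at x)"
    using assms by (auto simp: differentiable_def)
  then have lin: "linear F'" by (rule has_derivative_linear)
  have "F' = (\<lambda>h. h \<bullet> adjoint F' 1)"
    using adjoint_works[OF lin, of _ 1] by (auto simp: inner_commute)
  with F' have D: "GDERIV ?F x :> adjoint F' 1"
    by (simp add: gderiv_def)
  have "E = adjoint F' 1" if "GDERIV ?F x :> E" for E
  proof -
    have "(\<lambda>h. h \<bullet> E) = (\<lambda>h. h \<bullet> adjoint F' 1)"
      using that D unfolding gderiv_def by (rule has_derivative_unique)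
    then show ?thesis by (metis inner_commute vector_eq_rdot)
  qed
  with D show ?thesis
    unfolding grad_def by (rule theI)
qed

locale smooth_convex = growth_rate lam for lam +
  fixes f :: "real ^ 'n \<Rightarrow> ereal"
  assumes not_MInf: "\<And>y. f y \<noteq> - \<infinity>"
    and open_dom: "open (eff_domain f)"
    and convex_dom: "convex (eff_domain f)"
    and twice_diff: "twice_differentiable_on f (eff_domain f)"
    and cont_closure: "continuous_on (closure (eff_domain f)) f"
    and hessian_bound:
      "\<And>y. y \<in> eff_domain f \<Longrightarrow> spectral_norm (hessian f y) \<le> lam (norm (grad f y))"
    and cvx: "ext_convex f"
begin

abbreviation X :: "(real ^ 'n) set" where "X \<equiv> eff_domain f"
abbreviation F :: "real ^ 'n \<Rightarrow> real" where "F \<equiv> \<lambda>y. real_of_ereal (f y)"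

lemma f_eq_ereal: "y \<in> X \<Longrightarrow> f y = ereal (F y)"
  using not_MInf[of y] by (cases "f y") (auto simp: eff_domain_def)

lemma gderiv: "y \<in> X \<Longrightarrow> GDERIV F y :> grad f y"
  using twice_diff by (intro GDERIV_grad) (auto simp: twice_differentiable_on_def)

lemma ray_deriv:
  assumes "y + t *\<^sub>R u \<in> X"
  shows "((\<lambda>t. F (y + t *\<^sub>R u)) has_real_derivative grad f (y + t *\<^sub>R u) \<bullet> u) (at t)"
proof -
  have "((\<lambda>t. y + t *\<^sub>R u) has_derivative (\<lambda>r. r *\<^sub>R u)) (at t)"
    by (auto intro!: derivative_eq_intros)
  from diff_chain_at[OF this gderiv[OF assms, unfolded gderiv_def]]
  show ?thesis
    by (simp add: has_field_derivative_def o_def inner_commute mult_commute_abs)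
qed

lemma ray_grad_deriv:
  assumes "y + t *\<^sub>R u \<in> X"
  shows "((\<lambda>t. grad f (y + t *\<^sub>R u)) has_vector_derivative hessian f (y + t *\<^sub>R u) *v u) (at t)"
proof -
  have grad: "(grad f has_derivative (*v) (hessian f (y + t *\<^sub>R u))) (at (y + t *\<^sub>R u))"
    using twice_diff assms jacobian_works[of "grad f" "at (y + t *\<^sub>R u)"]
    by (simp add: twice_differentiable_on_def hessian_def)
  have "((\<lambda>t. y + t *\<^sub>R u) has_derivative (\<lambda>r. r *\<^sub>R u)) (at t)"
    by (auto intro!: derivative_eq_intros)
  from diff_chain_at[OF this grad] show ?thesis
    by (simp add: has_vector_derivative_def o_def matrix_vector_mult_scaleR)
qed

text \<open>
  The derivative at 0 along the segment is the limit of difference quotients, each of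
  which is at most \<open>F z - F y\<close> by convexity.
\<close>

lemma gradient_inequality:
  assumes y: "y \<in> X" and z: "z \<in> X"
  shows "F y + grad f y \<bullet> (z - y) \<le> F z"
proof -
  define \<phi> where "\<phi> t = F (y + t *\<^sub>R (z - y))" for t
  have "(\<phi> has_real_derivative grad f y \<bullet> (z - y)) (at 0)"
    using ray_deriv[of y 0 "z - y"] y by (simp add: \<phi>_def[abs_def])
  then have lim: "((\<lambda>t. (\<phi> t - \<phi> 0) / t) \<longlongrightarrow> grad f y \<bullet> (z - y)) (at_right 0)"
    by (auto simp: has_field_derivative_iff intro: tendsto_within_subset)
  have "(\<phi> t - \<phi> 0) / t \<le> F z - F y" if t: "0 < t" "t < 1" for t
  proof -
    have eq: "(1 - t) *\<^sub>R y + t *\<^sub>R z = y + t *\<^sub>R (z - y)"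
      by (simp add: algebra_simps)
    have "(1 - t) *\<^sub>R y + t *\<^sub>R z \<in> X"
      using convexD_alt[OF convex_dom y z] t by auto
    then have inX: "y + t *\<^sub>R (z - y) \<in> X" by (simp only: eq)
    have "f ((1 - t) *\<^sub>R y + t *\<^sub>R z) \<le> ereal (1 - t) * f y + ereal t * f z"
      using cvx t by (auto simp: ext_convex_def)
    moreover obtain p q r where "f (y + t *\<^sub>R (z - y)) = ereal p" "f y = ereal q" "f z = ereal r"
      using f_eq_ereal[OF inX] f_eq_ereal[OF y] f_eq_ereal[OF z] by blast
    ultimately have "\<phi> t \<le> (1 - t) * F y + t * F z"
      unfolding eq by (simp add: \<phi>_def)
    then have "\<phi> t - \<phi> 0 \<le> t * (F z - F y)"
      by (simp add: \<phi>_def algebra_simps)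
    then show ?thesis using t by (simp add: field_simps)
  qed
  then have "\<forall>\<^sub>F t in at_right 0. (\<phi> t - \<phi> 0) / t \<le> F z - F y"
    unfolding eventually_at_right_field by (auto intro!: exI[of _ 1])
  from tendsto_upperbound[OF lim this] show ?thesis by simp
qed

text \<open>
  The speed of the gradient along the ray is at most \<open>lam\<close> of its current norm, which
  is at most the initial norm plus the change; thus the comparison principle applies to
  the change.
\<close>

lemma grad_change_time:
  assumes u: "norm u = 1" and s: "0 \<le> s"
    and ray: "\<And>t. 0 \<le> t \<Longrightarrow> t \<le> s \<Longrightarrow> y + t *\<^sub>R u \<in> X"
  shows "growth_time (norm (grad f y)) (norm (grad f (y + s *\<^sub>R u) - grad f y)) \<le> s"
proof (rule growth_comparison[of _ s "\<lambda>t. grad f (y + t *\<^sub>R u) - grad f y"])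
  fix t assume t: "0 \<le> t" "t \<le> s"
  let ?z = "y + t *\<^sub>R u"
  have "((\<lambda>t. grad f (y + t *\<^sub>R u) - grad f y) has_vector_derivative hessian f ?z *v u - 0) (at t)"
    by (intro has_vector_derivative_diff ray_grad_deriv ray t has_vector_derivative_const)
  moreover have "norm (hessian f ?z *v u) \<le> lam (norm (grad f y) + norm (grad f ?z - grad f y))"
  proof -
    have "norm (hessian f ?z *v u) \<le> spectral_norm (hessian f ?z)"
      unfolding spectral_norm_def
      using onorm[OF matrix_vector_mul_bounded_linear, of "hessian f ?z" u] u by simp
    also have "\<dots> \<le> lam (norm (grad f ?z))"
      by (rule hessian_bound[OF ray[OF t]])
    also have "\<dots> \<le> lam (norm (grad f y) + norm (grad f ?z - grad f y))"
      by (intro lam_mono norm_ge_zero) (metis add.commute norm_triangle_sub)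
    finally show ?thesis .
  qed
  ultimately show "\<exists>h'. ((\<lambda>t. grad f (y + t *\<^sub>R u) - grad f y) has_vector_derivative h') (at t) \<and>
      norm h' \<le> lam (norm (grad f y) + norm (grad f ?z - grad f y))"
    by auto
qed (use s in auto)

text \<open>
  A ray that leaves the domain at a first time \<open>r\<close> has a bounded gradient before \<open>r\<close>,
  so \<open>f\<close> stays bounded along it; by continuity on the closure \<open>f\<close> is then finite at the
  exit point, which would therefore belong to the domain.
\<close>

lemma ray_in_dom:
  assumes y: "y \<in> X" and u: "norm u = 1" and M: "0 \<le> M"
    and s: "0 \<le> s" "s \<le> growth_time (norm (grad f y)) M"
  shows "y + s *\<^sub>R u \<in> X"
proof (rule ccontr)
  assume out: "y + s *\<^sub>R u \<notin> X"
  let ?a = "norm (grad f y)"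
  define S where "S = {t \<in> {0..s}. y + t *\<^sub>R u \<in> - X}"
  \<comment> \<open>The exit time is attained because the domain is open.\<close>
  have "closed S"
    unfolding S_def
    by (rule continuous_closed_preimage[unfolded vimage_def Int_def, simplified])
       (use open_dom in \<open>auto intro!: continuous_intros\<close>)
  moreover have "s \<in> S" using out s by (auto simp: S_def)
  moreover have bdd: "bdd_below S" by (auto simp: S_def bdd_below_def)
  ultimately have rS: "Inf S \<in> S"
    using closed_contains_Inf by blast
  define r where "r = Inf S"
  have r: "0 \<le> r" "r \<le> s" "y + r *\<^sub>R u \<notin> X"
    using rS by (auto simp: S_def r_def)
  with y have "r \<noteq> 0" by auto
  with r have rpos: "0 < r" by simp
  have before: "y + t *\<^sub>R u \<in> X" if "0 \<le> t" "t < r" for t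
  proof (rule ccontr)
    assume "y + t *\<^sub>R u \<notin> X"
    then have "t \<in> S" using that r by (auto simp: S_def)
    then have "r \<le> t" unfolding r_def by (rule cInf_lower[OF _ bdd])
    with that show False by simp
  qed
  have gbound: "norm (grad f (y + t *\<^sub>R u)) \<le> ?a + M" if "0 \<le> t" "t < r" for t
  proof -
    have "growth_time ?a (norm (grad f (y + t *\<^sub>R u) - grad f y)) \<le> t"
      by (rule grad_change_time) (use that before u in auto)
    then have "growth_time ?a (norm (grad f (y + t *\<^sub>R u) - grad f y)) \<le> growth_time ?a M"
      using that r s by simp
    then have "norm (grad f (y + t *\<^sub>R u) - grad f y) \<le> M"
      using M by (subst (asm) growth_time_le_iff) auto
    then show ?thesis
      using norm_triangle_sub[of "grad f (y + t *\<^sub>R u)" "grad f y"] by simp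
  qed
  have Fbound: "F (y + t *\<^sub>R u) \<le> F y + r * (?a + M)" if t: "0 \<le> t" "t < r" for t
  proof -
    have "F y + grad f y \<bullet> 0 \<ge> F (y + t *\<^sub>R u) + grad f (y + t *\<^sub>R u) \<bullet> (y - (y + t *\<^sub>R u))"
      using gradient_inequality[OF before[OF t] y] by simp
    then have "F (y + t *\<^sub>R u) \<le> F y + t * (grad f (y + t *\<^sub>R u) \<bullet> u)"
      by simp
    also have "t * (grad f (y + t *\<^sub>R u) \<bullet> u) \<le> r * (?a + M)"
    proof -
      have "grad f (y + t *\<^sub>R u) \<bullet> u \<le> ?a + M"
        using norm_cauchy_schwarz[of "grad f (y + t *\<^sub>R u)" u] u gbound[OF t] by simp
      then have "t * (grad f (y + t *\<^sub>R u) \<bullet> u) \<le> t * (?a + M)"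
        using t by (intro mult_left_mono) auto
      also have "\<dots> \<le> r * (?a + M)"
        using t M by (intro mult_right_mono) auto
      finally show ?thesis .
    qed
    finally show ?thesis by simp
  qed
  have lim: "((\<lambda>t. y + t *\<^sub>R u) \<longlongrightarrow> y + r *\<^sub>R u) (at_left r)"
    by (intro tendsto_intros)
  have ev: "\<forall>\<^sub>F t in at_left r. 0 < t \<and> t < r"
    unfolding eventually_at_left_field by (rule exI[of _ 0]) (use rpos in auto)
  have evX: "\<forall>\<^sub>F t in at_left r. y + t *\<^sub>R u \<in> closure X"
    using ev by eventually_elim (simp add: before subsetD[OF closure_subset])
  have "y + r *\<^sub>R u \<in> closure X"
    by (rule Lim_in_closed_set[OF closed_closure evX _ lim]) simp
  from continuous_on_tendsto_compose[OF cont_closure lim this evX]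
  have "((\<lambda>t. f (y + t *\<^sub>R u)) \<longlongrightarrow> f (y + r *\<^sub>R u)) (at_left r)" .
  moreover have "\<forall>\<^sub>F t in at_left r. f (y + t *\<^sub>R u) \<le> ereal (F y + r * (?a + M))"
    using ev 
  proof eventually_elim
    case (elim t)
    then show ?case
      using Fbound[of t] f_eq_ereal[OF before[of t]] by (metis ereal_less_eq(3) less_imp_le)
  qed
  ultimately have "f (y + r *\<^sub>R u) \<le> ereal (F y + r * (?a + M))"
    by (rule tendsto_upperbound) simp
  also have "\<dots> < \<infinity>" by simp
  finally show False using r(3) by (simp add: eff_domain_def)
qed

lemma grad_change:
  assumes y: "y \<in> X" and u: "norm u = 1" and M: "0 \<le> M"
    and s: "0 \<le> s" "s \<le> growth_time (norm (grad f y)) M"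
  shows "norm (grad f (y + s *\<^sub>R u) - grad f y) \<le> M"
proof -
  have "growth_time (norm (grad f y)) (norm (grad f (y + s *\<^sub>R u) - grad f y)) \<le> s"
    by (rule grad_change_time[OF u s(1) ray_in_dom[OF y u M]]) (use s in auto)
  then show ?thesis
    using s M by (subst growth_time_le_iff[symmetric, of "norm (grad f y)"]) auto
qed

text \<open>
  As long as the gradient has changed by at most \<open>M\<close>, it is Lipschitz along the ray with
  constant \<open>lam (norm (grad f y) + M)\<close>, and a change by \<open>M\<close> takes at least the stated
  time.  This linear bound suffices for every ray other than the step of the method itself,
  where the full doubling time is needed.
\<close>

lemma short_ray:
  assumes y: "y \<in> X" and u: "norm u = 1" and M: "0 \<le> M"
    and s: "0 \<le> s" "s \<le> M / lam (norm (grad f y) + M)"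
  shows short_ray_in_dom: "y + s *\<^sub>R u \<in> X"
    and short_ray_grad: "norm (grad f (y + s *\<^sub>R u) - grad f y) \<le> s * lam (norm (grad f y) + M)"
proof -
  let ?a = "norm (grad f y)" and ?d = "norm (grad f (y + s *\<^sub>R u) - grad f y)"
  have sM: "s \<le> growth_time ?a M"
    using growth_time_lower[of ?a M M] M s by simp
  show "y + s *\<^sub>R u \<in> X" by (rule ray_in_dom[OF y u M s(1) sM])
  have "?d \<le> M" by (rule grad_change[OF y u M s(1) sM])
  then have "?d / lam (?a + M) \<le> growth_time ?a ?d"
    by (intro growth_time_lower) auto
  also have "\<dots> \<le> s"
    by (rule grad_change_time[OF u s(1) ray_in_dom[OF y u M]]) (use s sM in auto)
  finally show "?d \<le> s * lam (?a + M)"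
    using lam_pos[of "?a + M"] M by (simp add: field_simps)
qed

lemma descent:
  assumes y: "y \<in> X" and u: "norm u = 1" and M: "0 \<le> M"
    and s: "0 \<le> s" "s \<le> M / lam (norm (grad f y) + M)"
  shows "F (y + s *\<^sub>R u) \<le> F y + s * (grad f y \<bullet> u) + lam (norm (grad f y) + M) * s\<^sup>2 / 2"
proof -
  let ?L = "lam (norm (grad f y) + M)"
  have "F (y + s *\<^sub>R u) - s * (grad f y \<bullet> u) - ?L * s\<^sup>2 / 2
      \<le> F (y + 0 *\<^sub>R u) - 0 * (grad f y \<bullet> u) - ?L * 0\<^sup>2 / 2"
  proof (rule DERIV_nonpos_imp_nonincreasing[OF s(1)])
    fix t assume t: "0 \<le> t" "t \<le> s"
    then have t': "t \<le> M / ?L" using s by simp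
    have "((\<lambda>t. F (y + t *\<^sub>R u) - t * (grad f y \<bullet> u) - ?L * t\<^sup>2 / 2) has_real_derivative
        grad f (y + t *\<^sub>R u) \<bullet> u - grad f y \<bullet> u - ?L * t) (at t)"
      using ray_deriv[OF short_ray_in_dom[OF y u M t(1) t']]
      by (auto intro!: derivative_eq_intros)
    moreover have "grad f (y + t *\<^sub>R u) \<bullet> u - grad f y \<bullet> u - ?L * t \<le> 0"
      using norm_cauchy_schwarz[of "grad f (y + t *\<^sub>R u) - grad f y" u] u
        short_ray_grad[OF y u M t(1) t'] by (simp add: inner_diff_left mult.commute)
    ultimately show "\<exists>D. ((\<lambda>t. F (y + t *\<^sub>R u) - t * (grad f y \<bullet> u) - ?L * t\<^sup>2 / 2)
        has_real_derivative D) (at t) \<and> D \<le> 0" by blast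
  qed
  then show ?thesis by simp
qed


section \<open>One step of gradient descent\<close>

lemma minimizer_in_dom:
  assumes "\<And>y. f xm \<le> f y" "y \<in> X"
  shows "xm \<in> X"
  using assms(1)[of y] assms(2) by (auto simp: eff_domain_def)

lemma minimizer_le:
  assumes min: "\<And>y. f xm \<le> f y" and y: "y \<in> X"
  shows "F xm \<le> F y"
  using min[of y] f_eq_ereal[OF y] f_eq_ereal[OF minimizer_in_dom[OF min y]]
  by (metis ereal_less_eq(3))

lemma grad_minimizer:
  assumes min: "\<And>y. f xm \<le> f y" and xm: "xm \<in> X"
  shows "grad f xm = 0"
proof -
  have "(\<lambda>h. h \<bullet> grad f xm) = (\<lambda>h. 0)"
    by (rule differential_zero_maxmin[OF xm open_dom gderiv[OF xm, unfolded gderiv_def]])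
       (use minimizer_le[OF min] in blast)
  then have "grad f xm \<bullet> grad f xm = 0" by meson
  then show ?thesis by simp
qed

definition step :: "real ^ 'n \<Rightarrow> real"
  where "step y = integral {0..1} (\<lambda>v. 1 / lam (norm (grad f y) + norm (grad f y) * v))"

lemma step_growth_time:
  "step y * norm (grad f y) = growth_time (norm (grad f y)) (norm (grad f y))"
  unfolding step_def by (simp add: growth_time_rescale)

lemma step_bounds:
  assumes "grad f y \<noteq> 0"
  shows step_lower: "1 / lam (2 * norm (grad f y)) \<le> step y"
    and step_upper: "step y \<le> 1 / lam (norm (grad f y))"
proof -
  let ?M = "norm (grad f y)"
  have "?M / lam (2 * ?M) \<le> step y * ?M"
    using growth_time_lower[of ?M ?M ?M] by (simp add: step_growth_time)
  moreover have "step y * ?M \<le> ?M / lam ?M"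
    using growth_time_upper[of ?M ?M] by (simp add: step_growth_time)
  ultimately show "1 / lam (2 * ?M) \<le> step y" "step y \<le> 1 / lam ?M"
    using assms lam_pos[of ?M] lam_pos[of "2 * ?M"] by (auto simp: field_simps)
qed

text \<open>
  During the step the gradient changes by at most its initial norm, so the new gradient
  still has a nonnegative inner product with the old one.  The gradient inequality at the
  new point then compares the two values, without integrating along the step.
\<close>

lemma step_decreases:
  assumes y: "y \<in> X"
  shows step_in_dom: "y - step y *\<^sub>R grad f y \<in> X"
    and step_le: "F (y - step y *\<^sub>R grad f y) \<le> F y"
proof -
  let ?g = "grad f y" and ?z = "y - step y *\<^sub>R grad f y"
  have "?z \<in> X \<and> F ?z \<le> F y"
  proof (cases "?g = 0")
    case True
    then show ?thesis using y by simp
  next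
    case False
    let ?M = "norm ?g"
    define u where "u = (- 1 / ?M) *\<^sub>R ?g"
    define s where "s = step y * ?M"
    have u: "norm u = 1" using False by (simp add: u_def)
    have z: "?z = y + s *\<^sub>R u" using False by (simp add: u_def s_def)
    have s: "0 \<le> s" "s \<le> growth_time ?M ?M"
      using growth_time_le_iff[of ?M 0 ?M] by (simp_all add: s_def step_growth_time)
    have st: "0 \<le> step y" using s(1) False by (simp add: s_def zero_le_mult_iff)
    have zX: "?z \<in> X" unfolding z by (rule ray_in_dom[OF y u _ s]) simp
    have "norm (grad f ?z - ?g) \<le> ?M" unfolding z by (rule grad_change[OF y u _ s]) simp
    then have "(?g - grad f ?z) \<bullet> ?g \<le> ?M * ?M"
      by (intro order_trans[OF norm_cauchy_schwarz] mult_right_mono) (auto simp: norm_minus_commute)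
    then have "0 \<le> grad f ?z \<bullet> ?g"
      by (simp add: inner_diff_left dot_square_norm power2_eq_square)
    then have "0 \<le> grad f ?z \<bullet> (y - ?z)"
      using st by simp
    then show ?thesis using gradient_inequality[OF zX y] zX by simp
  qed
  then show "?z \<in> X" "F ?z \<le> F y" by auto
qed

text \<open>
  The minimum lies below the value reached by walking against the gradient for the
  distance \<open>M / lam (2 * M)\<close>, within which the gradient norm is at most \<open>2 * M\<close>.
\<close>

lemma gap_ge_grad:
  assumes min: "\<And>y. f xm \<le> f y" and y: "y \<in> X"
  shows "(norm (grad f y))\<^sup>2 / (2 * lam (2 * norm (grad f y))) \<le> F y - F xm"
proof (cases "grad f y = 0")
  case True
  then show ?thesis using minimizer_le[OF min y] by simp
next
  case False
  let ?M = "norm (grad f y)"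
  let ?L = "lam (2 * ?M)"
  define u where "u = (- 1 / ?M) *\<^sub>R grad f y"
  have u: "norm u = 1" using False by (simp add: u_def)
  have gu: "grad f y \<bullet> u = - ?M"
    using False by (simp add: u_def dot_square_norm power2_eq_square)
  have L: "0 < ?L" by (rule lam_pos) simp
  have s: "0 \<le> ?M / ?L" "?M / ?L \<le> ?M / lam (?M + ?M)" using L by simp_all
  have "F xm \<le> F (y + (?M / ?L) *\<^sub>R u)"
    by (rule minimizer_le[OF min short_ray_in_dom[OF y u _ s]]) simp
  also have "\<dots> \<le> F y + ?M / ?L * (grad f y \<bullet> u) + lam (?M + ?M) * (?M / ?L)\<^sup>2 / 2"
    by (rule descent[OF y u _ s]) simp
  also have "\<dots> = F y - ?M\<^sup>2 / (2 * ?L)"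
    using L by (simp add: gu field_simps power2_eq_square)
  finally show ?thesis by simp
qed

text \<open>
  From the minimizer one walks in the direction of the gradient \<open>g\<close> at \<open>y\<close>, for the
  distance \<open>norm g / lam (norm g)\<close>.  The descent bound limits the value of \<open>f\<close> at the end
  from above, the tangent plane at \<open>y\<close> limits it from below, and the tangent plane gains
  \<open>norm g\<close> per unit of length.  Since the walk starts with gradient zero, the gradient
  norm is at most \<open>norm g\<close>; this is what puts \<open>lam (norm g)\<close>, and not
  \<open>lam (2 * norm g)\<close>, into the denominator.
\<close>

lemma cocoercive_minimizer:
  assumes min: "\<And>y. f xm \<le> f y" and y: "y \<in> X"
  shows "F y - F xm + (norm (grad f y))\<^sup>2 / (2 * lam (norm (grad f y))) \<le> grad f y \<bullet> (y - xm)"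
proof -
  have xm: "xm \<in> X" by (rule minimizer_in_dom[OF min y])
  have g0: "grad f xm = 0" by (rule grad_minimizer[OF min xm])
  show ?thesis
  proof (cases "grad f y = 0")
    case True
    then show ?thesis using gradient_inequality[OF y xm] by simp
  next
    case False
    let ?M = "norm (grad f y)"
    let ?L = "lam ?M"
    define u where "u = (1 / ?M) *\<^sub>R grad f y"
    let ?z = "xm + (?M / ?L) *\<^sub>R u"
    have u: "norm u = 1" using False by (simp add: u_def)
    have gu: "grad f y \<bullet> u = ?M"
      using False by (simp add: u_def dot_square_norm power2_eq_square)
    have L: "0 < ?L" by (rule lam_pos) simp
    have s: "0 \<le> ?M / ?L" "?M / ?L \<le> ?M / lam (norm (grad f xm) + ?M)"
      using L by (simp_all add: g0)
    have z: "?z \<in> X" by (rule short_ray_in_dom[OF xm u _ s]) simp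
    have "F y + grad f y \<bullet> (?z - y) \<le> F ?z" by (rule gradient_inequality[OF y z])
    also have "F ?z \<le> F xm + ?M / ?L * (grad f xm \<bullet> u)
        + lam (norm (grad f xm) + ?M) * (?M / ?L)\<^sup>2 / 2"
      by (rule descent[OF xm u _ s]) simp
    also have "\<dots> = F xm + ?M\<^sup>2 / (2 * ?L)"
      using L by (simp add: g0 field_simps power2_eq_square)
    finally have "F y + grad f y \<bullet> (?z - y) \<le> F xm + ?M\<^sup>2 / (2 * ?L)" .
    moreover have "grad f y \<bullet> (?z - y) = ?M\<^sup>2 / ?L - grad f y \<bullet> (y - xm)"
      by (simp add: inner_diff_right inner_add_right gu power2_eq_square)
    moreover have "?M\<^sup>2 / ?L = ?M\<^sup>2 / (2 * ?L) + ?M\<^sup>2 / (2 * ?L)"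
      using L by (simp add: field_simps)
    ultimately show ?thesis by linarith
  qed
qed

text \<open>
  Expanding the square leaves the error term \<open>step y ^ 2 * norm (grad f y) ^ 2\<close>, which
  the cocoercivity term compensates because \<open>step y \<le> 1 / lam (norm (grad f y))\<close>.
\<close>

lemma distance_recursion:
  assumes min: "\<And>y. f xm \<le> f y" and y: "y \<in> X"
  shows "(norm (y - step y *\<^sub>R grad f y - xm))\<^sup>2 + 2 * step y * (F y - F xm) \<le> (norm (y - xm))\<^sup>2"
proof (cases "grad f y = 0")
  case True
  have "F y = F xm"
    using True gradient_inequality[OF y minimizer_in_dom[OF min y]] minimizer_le[OF min y] by simp
  with True show ?thesis by simp
next
  case False
  let ?g = "grad f y" and ?\<gamma> = "step y" and ?w = "y - xm"
  let ?M = "norm ?g"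
  have L: "0 < lam ?M" "0 < lam (2 * ?M)" by (auto intro: lam_pos)
  have st: "0 \<le> ?\<gamma>"
    using step_lower[OF False] L(2) by (meson order_trans less_imp_le zero_less_divide_1_iff)
  have "?\<gamma> * ?M\<^sup>2 \<le> 1 / lam ?M * ?M\<^sup>2"
    by (intro mult_right_mono step_upper False) simp
  then have "2 * (F y - F xm) + ?\<gamma> * ?M\<^sup>2 \<le> 2 * (?g \<bullet> ?w)"
    using cocoercive_minimizer[OF min y] by simp
  then have "?\<gamma> * (2 * (F y - F xm) + ?\<gamma> * ?M\<^sup>2) \<le> ?\<gamma> * (2 * (?g \<bullet> ?w))"
    by (rule mult_left_mono[OF _ st])
  moreover have "(norm (y - ?\<gamma> *\<^sub>R ?g - xm))\<^sup>2
      = (norm ?w)\<^sup>2 - ?\<gamma> * (2 * (?g \<bullet> ?w)) + ?\<gamma> * (?\<gamma> * ?M\<^sup>2)"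
    unfolding power2_norm_eq_inner
    by (simp add: inner_diff_left inner_diff_right inner_commute algebra_simps)
  ultimately show ?thesis by (simp add: algebra_simps)
qed

text \<open>
  A contribution of at least \<open>R\<^sup>2 / T\<close> from each of the \<open>T + 1\<close> iterates \<open>0, \<dots>, T\<close> would
  exceed the initial squared distance.  The gap is nonincreasing, so it is the last
  iterate that satisfies the bound.
\<close>

lemma last_iterate_gap:
  assumes min: "\<And>y. f xm \<le> f y"
    and x0: "x 0 \<in> X" and rec: "\<And>k. x (Suc k) = x k - step (x k) *\<^sub>R grad f (x k)"
    and progress: "\<And>y. y \<in> X \<Longrightarrow> \<epsilon> < F y - F xm \<Longrightarrow>
      (norm (x 0 - xm))\<^sup>2 \<le> real T * (2 * step y * (F y - F xm))"
    and ne: "x 0 \<noteq> xm"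
  shows "x T \<in> X \<and> F (x T) - F xm \<le> \<epsilon>"
proof -
  have inX: "x k \<in> X" for k
    by (induction k) (simp_all add: x0 rec step_in_dom)
  have anti: "F (x n) \<le> F (x k)" if "k \<le> n" for k n
    using that by (induction rule: dec_induct) (auto simp: rec intro: order_trans[OF step_le[OF inX]])
  have sum: "(norm (x n - xm))\<^sup>2 + (\<Sum>k<n. 2 * step (x k) * (F (x k) - F xm)) \<le> (norm (x 0 - xm))\<^sup>2" for n
  proof (induction n)
    case (Suc n)
    with distance_recursion[OF min inX[of n]] show ?case by (simp add: rec)
  qed simp
  have "F (x T) - F xm \<le> \<epsilon>"
  proof (rule ccontr)
    assume "\<not> F (x T) - F xm \<le> \<epsilon>"
    then have big: "\<epsilon> < F (x k) - F xm" if "k < Suc T" for k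
      using anti[of k T] that by simp
    let ?R2 = "(norm (x 0 - xm))\<^sup>2"
    have "real (Suc T) * ?R2 = (\<Sum>k<Suc T. ?R2)" by simp
    also have "\<dots> \<le> (\<Sum>k<Suc T. real T * (2 * step (x k) * (F (x k) - F xm)))"
      by (intro sum_mono progress inX big) simp
    also have "\<dots> = real T * (\<Sum>k<Suc T. 2 * step (x k) * (F (x k) - F xm))"
      by (simp only: sum_distrib_left)
    also have "\<dots> \<le> real T * ?R2"
    proof (rule mult_left_mono)
      show "(\<Sum>k<Suc T. 2 * step (x k) * (F (x k) - F xm)) \<le> ?R2"
        using sum[of "Suc T"] by (meson le_add_same_cancel2 order_trans zero_le_power2)
    qed simp
    finally have "?R2 \<le> 0" by (simp add: algebra_simps)
    then show False using ne by simp
  qed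
  with inX show ?thesis by blast
qed

end

section \<open>The rate for power growth\<close>

lemma growth_rate_ell:
  assumes "0 < \<rho>" "0 < L0" "0 \<le> L1"
  shows "growth_rate (ell \<rho> L0 L1)"
proof
  show "continuous_on {0..} (ell \<rho> L0 L1)"
    unfolding ell_def[abs_def] using assms by (intro continuous_intros continuous_on_powr') auto
  show "0 < ell \<rho> L0 L1 s" for s
    using assms by (simp add: ell_def add_pos_nonneg)
  show "ell \<rho> L0 L1 s \<le> ell \<rho> L0 L1 t" if "0 \<le> s" "s \<le> t" for s t
    using assms that by (auto simp: ell_def intro!: mult_left_mono powr_mono2)
qed

text \<open>
  Here \<open>\<Delta>\<close> is the gap and \<open>Y\<close> is twice the gradient norm, so that the step size is at
  least \<open>1 / ell \<rho> L0 L1 Y\<close>.  If \<open>L0\<close> dominates, this is at least \<open>1 / (2 * L0)\<close>.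
  Otherwise \<open>ell \<rho> L0 L1 Y \<le> 2 * L1 * Y powr \<rho>\<close>, and the assumption relating gradient and
  gap becomes \<open>Y powr (2 - \<rho>) \<le> 16 * L1 * \<Delta>\<close>; eliminating \<open>Y\<close> leaves a power of \<open>\<Delta>\<close>
  with nonnegative exponent, where \<open>\<Delta>\<close> may be replaced by \<open>\<epsilon>\<close>.
\<close>

lemma gap_over_rate:
  assumes \<rho>: "0 < \<rho>" "\<rho> \<le> 1" and L0: "0 < L0" and L1: "0 \<le> L1"
    and Y: "0 \<le> Y" and \<epsilon>: "0 < \<epsilon>" "\<epsilon> \<le> \<Delta>"
    and gap: "Y\<^sup>2 / (8 * ell \<rho> L0 L1 Y) \<le> \<Delta>"
  shows "\<epsilon> / (2 * L0) \<le> \<Delta> / ell \<rho> L0 L1 Y \<or>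
    0 < L1 \<and> \<epsilon> powr (2 * (1 - \<rho>) / (2 - \<rho>)) / (32 * L1 powr (2 / (2 - \<rho>))) \<le> \<Delta> / ell \<rho> L0 L1 Y"
proof (cases "L1 * Y powr \<rho> \<le> L0")
  case True
  then have "ell \<rho> L0 L1 Y \<le> 2 * L0" "0 < ell \<rho> L0 L1 Y"
    using L0 L1 by (auto simp: ell_def add_pos_nonneg)
  then have "\<epsilon> / (2 * L0) \<le> \<Delta> / ell \<rho> L0 L1 Y"
    using \<epsilon> by (intro frac_le) auto
  then show ?thesis ..
next
  case False
  then have L1p: "0 < L1" and Yp: "0 < Y"
    using L0 L1 Y by (auto simp: less_le)
  have \<Delta>: "0 < \<Delta>" using \<epsilon> by simp
  let ?P = "Y powr \<rho>" and ?r = "\<rho> / (2 - \<rho>)"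
  have P: "0 < ?P" using Yp by simp
  have ell: "0 < ell \<rho> L0 L1 Y" "ell \<rho> L0 L1 Y \<le> 2 * L1 * ?P"
    using False L0 L1 P by (auto simp: ell_def add_pos_nonneg)
  have r: "0 \<le> ?r" "?r \<le> 1" using \<rho> by (auto simp: field_simps)
  have "Y\<^sup>2 \<le> 8 * ell \<rho> L0 L1 Y * \<Delta>"
    using gap ell(1) by (simp add: field_simps)
  also have "\<dots> \<le> 8 * (2 * L1 * ?P) * \<Delta>"
    using ell(2) \<Delta> by (intro mult_right_mono mult_left_mono) auto
  finally have "Y\<^sup>2 / ?P \<le> 16 * (L1 * \<Delta>)"
    using P by (simp add: field_simps)
  moreover have "Y powr (2 - \<rho>) = Y\<^sup>2 / ?P"
    using Yp by (simp add: powr_diff powr_numeral)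
  ultimately have "Y powr (2 - \<rho>) \<le> 16 * (L1 * \<Delta>)" by simp
  then have "(Y powr (2 - \<rho>)) powr ?r \<le> (16 * (L1 * \<Delta>)) powr ?r"
    using r by (intro powr_mono2) auto
  also have "\<dots> = 16 powr ?r * (L1 powr ?r * \<Delta> powr ?r)"
    using L1p \<Delta> by (simp add: powr_mult)
  also have "\<dots> \<le> 16 * (L1 powr ?r * \<Delta> powr ?r)"
    using powr_mono[OF r(2), of 16] by (intro mult_right_mono) auto
  finally have P_le: "?P \<le> 16 * (L1 powr ?r * \<Delta> powr ?r)"
    using \<rho> by (simp add: powr_powr)
  have ell_le: "ell \<rho> L0 L1 Y \<le> 32 * (L1 powr (2 / (2 - \<rho>)) * \<Delta> powr ?r)"
  proof -
    have "2 * L1 * ?P \<le> 2 * L1 * (16 * (L1 powr ?r * \<Delta> powr ?r))"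
      using P_le L1p by (intro mult_left_mono) auto
    moreover have "L1 * L1 powr ?r = L1 powr (1 + ?r)"
      using L1p by (simp add: powr_add)
    moreover have "1 + ?r = 2 / (2 - \<rho>)" using \<rho> by (simp add: field_simps)
    ultimately show ?thesis using ell(2) by (simp add: mult.assoc[symmetric])
  qed
  have e: "2 * (1 - \<rho>) / (2 - \<rho>) = 1 - ?r" using \<rho> by (simp add: field_simps)
  have "\<epsilon> powr (1 - ?r) \<le> \<Delta> powr (1 - ?r)"
    using \<epsilon> r by (intro powr_mono2) auto
  also have "\<Delta> powr (1 - ?r) = \<Delta> / \<Delta> powr ?r"
    using \<Delta> by (simp add: powr_diff)
  finally have "\<epsilon> powr (1 - ?r) / (32 * L1 powr (2 / (2 - \<rho>)))
      \<le> \<Delta> / \<Delta> powr ?r / (32 * L1 powr (2 / (2 - \<rho>)))"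
    by (intro divide_right_mono) auto
  also have "\<dots> = \<Delta> / (32 * (L1 powr (2 / (2 - \<rho>)) * \<Delta> powr ?r))"
    by (simp add: field_simps)
  also have "\<dots> \<le> \<Delta> / ell \<rho> L0 L1 Y"
    using ell_le ell(1) \<Delta> by (intro divide_left_mono mult_pos_pos) (auto simp: L1p)
  finally show ?thesis using L1p unfolding e by blast
qed

theorem mainTheorem9:
  fixes f :: "real ^ 'd \<Rightarrow> ereal"
    and x :: "nat \<Rightarrow> real ^ 'd"
    and xmin :: "real ^ 'd"
    and \<rho> L0 L1 R \<epsilon> :: real
    and T :: nat
  assumes "0 < \<rho>" and "\<rho> \<le> 1" and "L0 > 0" and "L1 \<ge> 0"
    and "gen_smooth \<rho> L0 L1 f"
    and "ext_convex f"
    and "\<forall>y. f xmin \<le> f y"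
    and "x 0 \<in> eff_domain f"
    and "R = norm (x 0 - xmin)"
    and "\<forall>k. x (Suc k) = x k - step_size \<rho> L0 L1 f (x k) *\<^sub>R grad f (x k)"
    and "\<epsilon> > 0"
    and "T = nat \<lceil>max (2 * L0 * R\<^sup>2 / \<epsilon>)
      (16 * L1 powr (2 / (2 - \<rho>)) * R\<^sup>2 / \<epsilon> powr (2 * (1 - \<rho>) / (2 - \<rho>)))\<rceil>"
  shows "f (x T) - f xmin \<le> ereal \<epsilon>"
proof -
  interpret growth_rate "ell \<rho> L0 L1"
    by (rule growth_rate_ell) fact+
  interpret smooth_convex "ell \<rho> L0 L1" f
    using assms(5,6) by unfold_locales (auto simp: gen_smooth_def)
  have min: "\<And>y. f xmin \<le> f y" using assms(7) by blast
  have step: "step_size \<rho> L0 L1 f = step"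
    by (auto simp: step_size_def step_def)
  have xmin: "xmin \<in> X" by (rule minimizer_in_dom[OF min assms(8)])
  let ?e = "2 * (1 - \<rho>) / (2 - \<rho>)" and ?p = "2 / (2 - \<rho>)"
  have T: "2 * L0 * R\<^sup>2 / \<epsilon> \<le> real T" "16 * L1 powr ?p * R\<^sup>2 / \<epsilon> powr ?e \<le> real T"
    unfolding assms(12) by linarith+
  have progress: "(norm (x 0 - xmin))\<^sup>2 \<le> real T * (2 * step y * (F y - F xmin))"
    if y: "y \<in> X" and gap: "\<epsilon> < F y - F xmin" for y
  proof -
    let ?\<Delta> = "F y - F xmin" and ?Y = "2 * norm (grad f y)"
    have g: "grad f y \<noteq> 0"
      using gradient_inequality[OF y xmin] gap \<open>\<epsilon> > 0\<close> by auto
    have "?Y\<^sup>2 / (8 * ell \<rho> L0 L1 ?Y) \<le> ?\<Delta>"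
      using gap_ge_grad[OF min y] by (simp add: power_mult_distrib)
    from gap_over_rate[OF assms(1-4) _ \<open>\<epsilon> > 0\<close> less_imp_le[OF gap] this]
    consider "\<epsilon> / (2 * L0) \<le> ?\<Delta> / ell \<rho> L0 L1 ?Y"
      | "0 < L1" "\<epsilon> powr ?e / (32 * L1 powr ?p) \<le> ?\<Delta> / ell \<rho> L0 L1 ?Y"
      by auto
    then have "R\<^sup>2 \<le> real T * (2 * (?\<Delta> / ell \<rho> L0 L1 ?Y))"
    proof cases
      case 1
      have "R\<^sup>2 \<le> (2 * L0 * R\<^sup>2 / \<epsilon>) * (2 * (\<epsilon> / (2 * L0)))"
        using assms(3,11) by simp
      also have "\<dots> \<le> real T * (2 * (?\<Delta> / ell \<rho> L0 L1 ?Y))"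
        using 1 T(1) assms(3,11) by (intro mult_mono) auto
      finally show ?thesis .
    next
      case 2
      have "R\<^sup>2 \<le> (16 * L1 powr ?p * R\<^sup>2 / \<epsilon> powr ?e) * (2 * (\<epsilon> powr ?e / (32 * L1 powr ?p)))"
        using 2(1) assms(11) by simp
      also have "\<dots> \<le> real T * (2 * (?\<Delta> / ell \<rho> L0 L1 ?Y))"
        using 2(2) T(2) by (intro mult_mono) auto
      finally show ?thesis .
    qed
    also have "\<dots> \<le> real T * (2 * step y * ?\<Delta>)"
    proof (rule mult_left_mono)
      have "1 / ell \<rho> L0 L1 ?Y * ?\<Delta> \<le> step y * ?\<Delta>"
        using gap \<open>\<epsilon> > 0\<close> by (intro mult_right_mono step_lower[OF g]) simp
      then have "?\<Delta> / ell \<rho> L0 L1 ?Y \<le> step y * ?\<Delta>" by simp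
      then show "2 * (?\<Delta> / ell \<rho> L0 L1 ?Y) \<le> 2 * step y * ?\<Delta>"
        unfolding mult.assoc by (rule mult_left_mono) simp
    qed simp
    finally show ?thesis by (simp add: assms(9))
  qed
  have "x T \<in> X \<and> F (x T) - F xmin \<le> \<epsilon>"
  proof (cases "x 0 = xmin")
    case True
    then have "T = 0" using assms(9,12) by simp
    then show ?thesis using True xmin \<open>\<epsilon> > 0\<close> by simp
  next
    case False
    show ?thesis
    proof (rule last_iterate_gap[where x = x])
      show "x (Suc k) = x k - step (x k) *\<^sub>R grad f (x k)" for k
        using assms(10) by (simp add: step)
    qed (use min assms(8) progress False in blast)+
  qed
  then obtain a b where "f (x T) = ereal a" "f xmin = ereal b" "a - b \<le> \<epsilon>"
    using f_eq_ereal[of "x T"] f_eq_ereal[OF xmin] by (metis real_of_ereal.simps(1))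
  then show ?thesis by simp
qed

end
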